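(* Let $\nu>0$, $\lambda>0$, let $F\in C(\mathbb R,\mathbb R)$ be Lipschitz continuous on bounded sets with $F(0)=0$, and assume there is a constant $\alpha>0$ with $sF(s)\le-\alpha s^2$ for all $s\in\mathbb R$. Let $\mathfrak f=(f_i)_{i\in\mathbb Z}\in C(\mathbb R,\ell_2)$ be Lagrange stable and put $C:=\sup\{\|\mathfrak f(t)\|\mid t\in\mathbb R\}$. For $n\in\mathbb N$ let $\mathfrak f^n:=P_n(\mathfrak f)=(f_i)_{|i|\le n}$ and let $\widetilde{\mathfrak g}\in H(\mathfrak f^n)$. Then for every $T>0$ and $v_0\in\mathbb R^{2n+1}$, the solution $v(t)$ of $$\dot v_i=\nu(v_{i-1}-2v_i+v_{i+1})-\lambda v_i+F(v_i)+\widetilde g_i(t)\quad(|i|\le n),\qquad v_{n+1}:=v_{-n},\ v_{-n-1}:=v_n,\qquad v(0)=v_0,$$ satisfies $$\|v(t)\|\le M\quad\text{for all }0\le t\le T,$$ where $M$ is a constant depending only on $\lambda$, $C$, $\|v_0\|$ and $T$ (in particular not on $n$).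
   Context: $\ell_2$ is the Hilbert space of two-sided real square-summable sequences; $\mathbb R^{2n+1}$ has coordinates indexed by $|i|\le n$ and the Euclidean norm. For a Banach space $\mathfrak B$, $C(\mathbb R,\mathfrak B)$ carries the compact-open topology, $\mathfrak f^{(h)}(t)=\mathfrak f(t+h)$, $H(\mathfrak f)$ is the closure of $\{\mathfrak f^{(h)}\mid h\in\mathbb R\}$ in $C(\mathbb R,\mathfrak B)$ (here $\mathfrak B=\ell_2$ for $\mathfrak f$ and $\mathfrak B=\mathbb R^{2n+1}$ for $\mathfrak f^n$), and $\mathfrak f$ is Lagrange stable (translation-compact) if $H(\mathfrak f)$ is compact. *)

theory Defs
  imports "HOL-Analysis.Analysis"
begin

section \<open>The Hilbert space of two-sided square-summable real sequences\<close>

typedef ell2 = "{x :: int \<Rightarrow> real. (\<lambda>i. (x i)\<^sup>2) summable_on UNIV}"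
  morphisms coord Abs_ell2
proof
  show "(\<lambda>_. 0) \<in> {x :: int \<Rightarrow> real. (\<lambda>i. (x i)\<^sup>2) summable_on UNIV}"
    by simp
qed

lemma coord_summable: "(\<lambda>i. (coord x i)\<^sup>2) summable_on UNIV"
  using coord[of x] by simp

lemma ell2_eqI: "(\<And>i. coord x i = coord y i) \<Longrightarrow> x = y"
  by (metis coord_inject ext)

lemma coord_mult_summable: "(\<lambda>i. coord x i * coord y i) summable_on UNIV"
proof (rule abs_summable_summable)
  have "(\<lambda>i. (coord x i)\<^sup>2 + (coord y i)\<^sup>2) summable_on UNIV"
    by (intro summable_on_add coord_summable)
  then show "(\<lambda>i. norm (coord x i * coord y i)) summable_on UNIV"
  proof (rule summable_on_comparison_test)
    fix i
    have "2 * (\<bar>coord x i\<bar> * \<bar>coord y i\<bar>) \<le> (coord x i)\<^sup>2 + (coord y i)\<^sup>2"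
      using sum_squares_bound[of "\<bar>coord x i\<bar>" "\<bar>coord y i\<bar>"] by (simp add: mult.assoc)
    moreover have "0 \<le> \<bar>coord x i\<bar> * \<bar>coord y i\<bar>"
      by simp
    ultimately show "norm (coord x i * coord y i) \<le> (coord x i)\<^sup>2 + (coord y i)\<^sup>2"
      unfolding real_norm_def abs_mult by linarith
  qed auto
qed

lemma square_summable_add:
  fixes x y :: "int \<Rightarrow> real"
  assumes "(\<lambda>i. (x i)\<^sup>2) summable_on UNIV" "(\<lambda>i. (y i)\<^sup>2) summable_on UNIV"
  shows "(\<lambda>i. (x i + y i)\<^sup>2) summable_on UNIV"
proof (rule summable_on_comparison_test)
  show "(\<lambda>i. 2 * (x i)\<^sup>2 + 2 * (y i)\<^sup>2) summable_on UNIV"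
    by (intro summable_on_add summable_on_cmult_right assms)
  show "(x i + y i)\<^sup>2 \<le> 2 * (x i)\<^sup>2 + 2 * (y i)\<^sup>2" for i
    using zero_le_power2[of "x i - y i"] unfolding power2_sum power2_diff by linarith
qed auto

lemma square_summable_scale:
  fixes x :: "int \<Rightarrow> real"
  assumes "(\<lambda>i. (x i)\<^sup>2) summable_on UNIV"
  shows "(\<lambda>i. (c * x i)\<^sup>2) summable_on UNIV"
  unfolding power_mult_distrib by (intro summable_on_cmult_right assms)

instantiation ell2 :: real_inner
begin

definition "0 = Abs_ell2 (\<lambda>_. 0)"
definition "x + y = Abs_ell2 (\<lambda>i. coord x i + coord y i)"
definition "- x = Abs_ell2 (\<lambda>i. - coord x i)"
definition "x - y = Abs_ell2 (\<lambda>i. coord x i - coord y i)"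
definition "c *\<^sub>R x = Abs_ell2 (\<lambda>i. c * coord x i)"
definition inner_ell2_def: "x \<bullet> y = (\<Sum>\<^sub>\<infinity>i. coord x i * coord y i)"
definition norm_ell2_def: "norm x = sqrt (\<Sum>\<^sub>\<infinity>i. (coord x i)\<^sup>2)"
definition "sgn (x :: ell2) = inverse (norm x) *\<^sub>R x"
definition "dist x y = norm (x - y :: ell2)"
definition [code del]: "(uniformity :: (ell2 \<times> ell2) filter) = (INF e\<in>{0<..}. principal {(x, y). dist x y < e})"
definition [code del]: "open (U :: ell2 set) \<longleftrightarrow> (\<forall>x\<in>U. eventually (\<lambda>(x', y). x' = x \<longrightarrow> y \<in> U) uniformity)"

lemma coord_zero [simp]: "coord 0 i = 0"
  unfolding zero_ell2_def by (subst Abs_ell2_inverse) auto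

lemma coord_add [simp]: "coord (x + y) i = coord x i + coord y i"
  unfolding plus_ell2_def
  by (subst Abs_ell2_inverse) (auto intro!: square_summable_add coord_summable)

lemma coord_uminus [simp]: "coord (- x) i = - coord x i"
  unfolding uminus_ell2_def by (subst Abs_ell2_inverse) (auto intro!: coord_summable)

lemma coord_scaleR [simp]: "coord (c *\<^sub>R x) i = c * coord x i"
  unfolding scaleR_ell2_def
  by (subst Abs_ell2_inverse) (auto intro!: square_summable_scale coord_summable)

lemma coord_diff [simp]: "coord (x - y) i = coord x i - coord y i"
proof -
  have "(\<lambda>i. (coord x i - coord y i)\<^sup>2) summable_on UNIV"
    using coord_summable[of "x + - y"] by simp
  then show ?thesis
    unfolding minus_ell2_def by (subst Abs_ell2_inverse) auto
qed

instance
proof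
  fix x y z :: ell2 and a b r :: real
  show "x + y + z = x + (y + z)" "x + y = y + x" "0 + x = x" "- x + x = 0" "x - y = x + - y"
    "a *\<^sub>R (x + y) = a *\<^sub>R x + a *\<^sub>R y" "(a + b) *\<^sub>R x = a *\<^sub>R x + b *\<^sub>R x"
    "a *\<^sub>R b *\<^sub>R x = (a * b) *\<^sub>R x" "1 *\<^sub>R x = x"
    by (auto intro!: ell2_eqI simp: algebra_simps)
  show "dist x y = norm (x - y)" by (fact dist_ell2_def)
  show "sgn x = inverse (norm x) *\<^sub>R x" by (fact sgn_ell2_def)
  show "(uniformity :: (ell2 \<times> ell2) filter) = (INF e\<in>{0<..}. principal {(x, y). dist x y < e})"
    by (fact uniformity_ell2_def)
  show "open U \<longleftrightarrow> (\<forall>x\<in>U. eventually (\<lambda>(x', y). x' = x \<longrightarrow> y \<in> U) uniformity)" for U :: "ell2 set"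
    by (fact open_ell2_def)
  show "x \<bullet> y = y \<bullet> x"
    by (simp add: inner_ell2_def mult.commute)
  show "(x + y) \<bullet> z = x \<bullet> z + y \<bullet> z"
    by (simp add: inner_ell2_def distrib_right infsum_add coord_mult_summable)
  show "(r *\<^sub>R x) \<bullet> y = r * (x \<bullet> y)"
    by (simp add: inner_ell2_def mult.assoc infsum_cmult_right')
  show nonneg: "0 \<le> x \<bullet> x"
    unfolding inner_ell2_def by (rule infsum_nonneg) simp
  show "x \<bullet> x = 0 \<longleftrightarrow> x = 0"
  proof
    assume "x \<bullet> x = 0"
    then have "coord x i * coord x i = 0" for i
      using nonneg_infsum_le_0D[of "\<lambda>i. coord x i * coord x i" UNIV i] coord_mult_summable[of x x]
      by (simp add: inner_ell2_def)
    then show "x = 0" by (auto intro!: ell2_eqI)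
  qed (simp add: inner_ell2_def)
  show "norm x = sqrt (x \<bullet> x)"
    by (simp add: norm_ell2_def inner_ell2_def power2_eq_square)
qed

end

lemma sum_coord_le_norm:
  assumes "finite A"
  shows "(\<Sum>i\<in>A. (coord x i)\<^sup>2) \<le> (norm x)\<^sup>2"
proof -
  have "(norm x)\<^sup>2 = (\<Sum>\<^sub>\<infinity>i. (coord x i)\<^sup>2)"
    unfolding norm_ell2_def by (simp add: infsum_nonneg)
  then show ?thesis
    using finite_sum_le_infsum[OF coord_summable assms, of x] by simp
qed

lemma norm_ell2_le:
  assumes "0 \<le> e" "\<And>A. finite A \<Longrightarrow> (\<Sum>i\<in>A. (coord x i)\<^sup>2) \<le> e\<^sup>2"
  shows "norm x \<le> e"
  unfolding norm_ell2_def
  using infsum_le_finite_sums[OF coord_summable, of x "e\<^sup>2"] assms by (simp add: real_le_lsqrt)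

lemma abs_coord_le_norm: "\<bar>coord x i\<bar> \<le> norm x"
  using sum_coord_le_norm[of "{i}" x] by (simp add: abs_le_square_iff[symmetric])

instance ell2 :: complete_space
proof
  fix X :: "nat \<Rightarrow> ell2"
  assume X: "Cauchy X"
  have "Cauchy (\<lambda>k. coord (X k) i)" for i
  proof (rule metric_CauchyI)
    fix e :: real assume "0 < e"
    then obtain N where N: "\<And>m n. m \<ge> N \<Longrightarrow> n \<ge> N \<Longrightarrow> norm (X m - X n) < e"
      using CauchyD[OF X] by blast
    have "dist (coord (X m) i) (coord (X n) i) < e" if "m \<ge> N" "n \<ge> N" for m n
      using abs_coord_le_norm[of "X m - X n" i] N[OF that] by (simp add: dist_real_def)
    then show "\<exists>N. \<forall>m\<ge>N. \<forall>n\<ge>N. dist (coord (X m) i) (coord (X n) i) < e" by blast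
  qed
  then have "\<exists>l. (\<lambda>k. coord (X k) i) \<longlonglongrightarrow> l" for i
    by (simp add: Cauchy_convergent_iff convergent_def)
  then obtain l where l: "\<And>i. (\<lambda>k. coord (X k) i) \<longlonglongrightarrow> l i" by metis
  have tail: "\<exists>N. \<forall>m\<ge>N. \<forall>A. finite A \<longrightarrow> (\<Sum>i\<in>A. (coord (X m) i - l i)\<^sup>2) \<le> e\<^sup>2"
    if e: "0 < e" for e
  proof -
    obtain N where N: "\<And>m n. m \<ge> N \<Longrightarrow> n \<ge> N \<Longrightarrow> norm (X m - X n) < e"
      using CauchyD[OF X e] by blast
    have "(\<Sum>i\<in>A. (coord (X m) i - l i)\<^sup>2) \<le> e\<^sup>2" if "m \<ge> N" "finite A" for m A
    proof (rule Lim_bounded)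
      show "(\<lambda>k. \<Sum>i\<in>A. (coord (X m) i - coord (X k) i)\<^sup>2) \<longlonglongrightarrow> (\<Sum>i\<in>A. (coord (X m) i - l i)\<^sup>2)"
        by (intro tendsto_intros l)
      show "\<forall>k\<ge>N. (\<Sum>i\<in>A. (coord (X m) i - coord (X k) i)\<^sup>2) \<le> e\<^sup>2"
      proof (intro allI impI)
        fix k assume "N \<le> k"
        then have "(norm (X m - X k))\<^sup>2 \<le> e\<^sup>2"
          using N[OF \<open>m \<ge> N\<close>, of k] by (intro power_mono) auto
        with sum_coord_le_norm[OF \<open>finite A\<close>, of "X m - X k"]
        show "(\<Sum>i\<in>A. (coord (X m) i - coord (X k) i)\<^sup>2) \<le> e\<^sup>2" by simp
      qed
    qed
    then show ?thesis by blast
  qed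
  obtain N where N: "\<And>A. finite A \<Longrightarrow> (\<Sum>i\<in>A. (coord (X N) i - l i)\<^sup>2) \<le> 1"
    using tail[of 1] by auto
  have "(\<lambda>i. (coord (X N) i - l i)\<^sup>2) summable_on UNIV"
    by (rule nonneg_bdd_above_summable_on) (use N in \<open>auto intro!: bdd_aboveI[of _ 1]\<close>)
  then have "(\<lambda>i. (coord (X N) i + (- 1) * (coord (X N) i - l i))\<^sup>2) summable_on UNIV"
    by (intro square_summable_add square_summable_scale coord_summable)
  then have "(\<lambda>i. (l i)\<^sup>2) summable_on UNIV" by simp
  then have L: "coord (Abs_ell2 l) = l" by (simp add: Abs_ell2_inverse)
  have "X \<longlonglongrightarrow> Abs_ell2 l"
  proof (rule LIMSEQ_I)
    fix e :: real assume "0 < e"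
    then obtain K where K: "\<And>m A. m \<ge> K \<Longrightarrow> finite A \<Longrightarrow> (\<Sum>i\<in>A. (coord (X m) i - l i)\<^sup>2) \<le> (e / 2)\<^sup>2"
      using tail[of "e / 2"] by auto
    have "norm (X m - Abs_ell2 l) \<le> e / 2" if "m \<ge> K" for m
      by (rule norm_ell2_le) (use K[OF that] L \<open>0 < e\<close> in auto)
    with \<open>0 < e\<close> show "\<exists>K. \<forall>m\<ge>K. norm (X m - Abs_ell2 l) < e"
      by (intro exI[of _ K]) (fastforce)
  qed
  then show "convergent X" by (auto simp: convergent_def)
qed


section \<open>Euclidean space with coordinates indexed by \<open>\<bar>i\<bar> \<le> n\<close>\<close>

text \<open>
  The dimension has to vary inside a single statement, so the space is an explicit carrier set of
  functions on \<open>{-n..n}\<close> (extended by \<open>undefined\<close>, as usual for \<open>extensional\<close>) and not a type.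
\<close>

definition Rvec :: "nat \<Rightarrow> (int \<Rightarrow> real) set" where
  "Rvec n = {- int n..int n} \<rightarrow>\<^sub>E UNIV"

definition Rnorm :: "nat \<Rightarrow> (int \<Rightarrow> real) \<Rightarrow> real" where
  "Rnorm n v = L2_set v {- int n..int n}"

definition Rdist :: "nat \<Rightarrow> (int \<Rightarrow> real) \<Rightarrow> (int \<Rightarrow> real) \<Rightarrow> real" where
  "Rdist n v w = Rnorm n (\<lambda>i. v i - w i)"

definition Rtop :: "nat \<Rightarrow> (int \<Rightarrow> real) topology" where
  "Rtop n = Metric_space.mtopology (Rvec n) (Rdist n)"

lemma Metric_space_Rvec: "Metric_space (Rvec n) (Rdist n)"
proof
  fix x y z :: "int \<Rightarrow> real"
  show "0 \<le> Rdist n x y" by (simp add: Rdist_def Rnorm_def)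
  show "Rdist n x y = Rdist n y x"
    by (simp add: Rdist_def Rnorm_def L2_set_def power2_commute)
  show "Rdist n x y = 0 \<longleftrightarrow> x = y" if "x \<in> Rvec n" "y \<in> Rvec n"
    using that by (auto simp: Rdist_def Rnorm_def Rvec_def L2_set_eq_0_iff intro: PiE_ext)
  have "Rnorm n (\<lambda>i. (x i - y i) + (y i - z i)) \<le> Rdist n x y + Rdist n y z"
    unfolding Rdist_def Rnorm_def by (rule L2_set_triangle_ineq)
  then show "Rdist n x z \<le> Rdist n x y + Rdist n y z" by (simp add: Rdist_def)
qed

lemma topspace_Rtop [simp]: "topspace (Rtop n) = Rvec n"
  unfolding Rtop_def by (rule Metric_space.topspace_mtopology[OF Metric_space_Rvec])

definition coord_proj :: "nat \<Rightarrow> ell2 \<Rightarrow> int \<Rightarrow> real" where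
  "coord_proj n x = restrict (coord x) {- int n..int n}"

definition periodic_ext :: "nat \<Rightarrow> (int \<Rightarrow> real) \<Rightarrow> int \<Rightarrow> real" where
  "periodic_ext n v i =
     (if i = int n + 1 then v (- int n) else if i = - int n - 1 then v (int n) else v i)"


section \<open>Compact-open topology, hulls and Lagrange stability\<close>

definition compact_open_topology :: "'b topology \<Rightarrow> (real \<Rightarrow> 'b) topology" where
  "compact_open_topology Y = topology_generated_by
     {{f. continuous_map euclideanreal Y f \<and> f ` K \<subseteq> U} | K U. compact K \<and> openin Y U}"

lemma topspace_compact_open_topology [simp]:
  "topspace (compact_open_topology Y) = {f. continuous_map euclideanreal Y f}"
proof -
  have "{f. continuous_map euclideanreal Y f} \<in>
      {{f. continuous_map euclideanreal Y f \<and> f ` K \<subseteq> U} | K U. compact K \<and> openin Y U}"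
    by (rule CollectI, rule exI[of _ "{}"], rule exI[of _ "{}"]) auto
  then show ?thesis
    unfolding compact_open_topology_def topology_generated_by_topspace by blast
qed

definition translate :: "(real \<Rightarrow> 'b) \<Rightarrow> real \<Rightarrow> real \<Rightarrow> 'b" where
  "translate f h = (\<lambda>t. f (t + h))"

definition translation_hull :: "'b topology \<Rightarrow> (real \<Rightarrow> 'b) \<Rightarrow> (real \<Rightarrow> 'b) set" where
  "translation_hull Y f = compact_open_topology Y closure_of (range (translate f))"

definition lagrange_stable :: "'b topology \<Rightarrow> (real \<Rightarrow> 'b) \<Rightarrow> bool" where
  "lagrange_stable Y f \<longleftrightarrow> compactin (compact_open_topology Y) (translation_hull Y f)"


section \<open>The truncated lattice system\<close>

definition lipschitz_on_bounded :: "(real \<Rightarrow> real) \<Rightarrow> bool" where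
  "lipschitz_on_bounded F \<longleftrightarrow> (\<forall>B. bounded B \<longrightarrow> (\<exists>L. L-lipschitz_on B F))"

text \<open>The derivatives at the endpoints of \<open>[0, T]\<close> are one-sided.\<close>

definition truncated_solution ::
  "real \<Rightarrow> real \<Rightarrow> (real \<Rightarrow> real) \<Rightarrow> nat \<Rightarrow> (real \<Rightarrow> int \<Rightarrow> real) \<Rightarrow> real \<Rightarrow> (int \<Rightarrow> real) \<Rightarrow>
   (real \<Rightarrow> int \<Rightarrow> real) \<Rightarrow> bool" where
  "truncated_solution \<nu> lam F n g T v0 v \<longleftrightarrow>
     (\<forall>t\<in>{0..T}. v t \<in> Rvec n) \<and> v 0 = v0 \<and>
     (\<forall>t\<in>{0..T}. \<forall>i\<in>{- int n..int n}.
        ((\<lambda>s. v s i) has_real_derivative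
           \<nu> * (periodic_ext n (v t) (i - 1) - 2 * v t i + periodic_ext n (v t) (i + 1))
             - lam * v t i + F (v t i) + g t i) (at t within {0..T}))"

end

theory Submission
  imports Defs
begin

text \<open>
  The bound is a Gronwall argument for the energy \<open>E t = (Rnorm n (v t))\<^sup>2\<close>.  Multiplying the
  \<open>i\<close>-th equation by \<open>2 * v\<^sub>i\<close> and summing over \<open>\<bar>i\<bar> \<le> n\<close>, the diffusion term contributes nothing
  positive because the periodic discrete Laplacian is negative semidefinite
  (\<open>periodic_laplacian_dissipative\<close>), the nonlinearity nothing positive because \<open>s * F s \<le> 0\<close>, and
  Young's inequality splits the forcing term so that
  \<open>E' \<le> - lam * E + C\<^sup>2 / lam\<close> (\<open>truncated_energy_inequality\<close>).  None of these estimates sees \<open>n\<close> or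
  \<open>\<nu>\<close>.  Integrating with the factor \<open>exp (lam * t)\<close> gives \<open>E t \<le> E 0 + (C / lam)\<^sup>2\<close>.

  The remaining point is that every \<open>g\<close> in the hull of the projected forcing inherits the bound
  \<open>Rnorm n (g t) \<le> C\<close>.  Evaluation at a fixed time is continuous in the compact-open topology, so
  \<open>g t\<close> lies in the closure of the values of the projected forcing, all of which lie in a closed
  ball of radius \<open>C\<close>.  The same continuity shows that a Lagrange stable \<open>f\<close> has bounded range: it is
  contained in the image of the compact hull under evaluation.  Without this the supremum \<open>C\<close> would
  bound nothing.
\<close>

section \<open>Evaluation on hulls\<close>

lemma continuous_map_eval_compact_open:
  "continuous_map (compact_open_topology Y) Y (\<lambda>f. f t)"
proof -
  have "openin (compact_open_topology Y) {f \<in> topspace (compact_open_topology Y). f t \<in> U}"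
    if "openin Y U" for U
  proof -
    have "{f \<in> topspace (compact_open_topology Y). f t \<in> U} =
        {f. continuous_map euclideanreal Y f \<and> f ` {t} \<subseteq> U}"
      by auto
    moreover have "openin (compact_open_topology Y)
        {f. continuous_map euclideanreal Y f \<and> f ` {t} \<subseteq> U}"
      unfolding compact_open_topology_def
      by (rule topology_generated_by_Basis, rule CollectI, rule exI[of _ "{t}"], rule exI[of _ U])
        (simp add: that)
    ultimately show ?thesis by simp
  qed
  moreover have "(\<lambda>f. f t) \<in> topspace (compact_open_topology Y) \<rightarrow> topspace Y"
  proof
    fix f assume "f \<in> topspace (compact_open_topology Y)"
    then have "continuous_map euclideanreal Y f" by simp
    from continuous_map_funspace[OF this] show "f t \<in> topspace Y" by auto
  qed
  ultimately show ?thesis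
    by (subst continuous_map_def) blast
qed

lemma translation_hull_eval_in_closedin:
  assumes g: "g \<in> translation_hull Y f" and S: "closedin Y S" and f: "range f \<subseteq> S"
  shows "g t \<in> S"
proof -
  have "(\<lambda>h. h t) ` (compact_open_topology Y closure_of range (translate f))
      \<subseteq> Y closure_of (\<lambda>h. h t) ` range (translate f)"
    by (rule continuous_map_image_closure_subset[OF continuous_map_eval_compact_open])
  also have "\<dots> \<subseteq> S"
    by (rule closure_of_minimal[OF _ S]) (use f in \<open>auto simp: translate_def\<close>)
  finally show ?thesis
    using g unfolding translation_hull_def by blast
qed

lemma lagrange_stable_imp_bounded_range:
  fixes f :: "real \<Rightarrow> 'b::metric_space"
  assumes f: "continuous_on UNIV f" and "lagrange_stable euclidean f"
  shows "bounded (range f)"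
proof -
  have "compactin euclidean ((\<lambda>h. h 0) ` translation_hull euclidean f)"
    using assms(2) unfolding lagrange_stable_def
    by (rule image_compactin[OF _ continuous_map_eval_compact_open])
  then have "bounded ((\<lambda>h. h 0) ` translation_hull euclidean f)"
    by (simp add: compact_imp_bounded)
  moreover have "range f \<subseteq> (\<lambda>h. h 0) ` translation_hull euclidean f"
  proof
    fix x assume "x \<in> range f"
    then obtain s where s: "x = translate f s 0" by (auto simp: translate_def)
    have "continuous_on UNIV (translate f r)" for r
      unfolding translate_def
      by (rule continuous_on_compose2[OF f]) (auto intro!: continuous_intros)
    then have "range (translate f) \<subseteq> translation_hull euclidean f"
      unfolding translation_hull_def by (intro closure_of_subset) auto
    with s show "x \<in> (\<lambda>h. h 0) ` translation_hull euclidean f" by blast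
  qed
  ultimately show ?thesis by (rule bounded_subset)
qed

lemma Rnorm_power2: "(Rnorm n v)\<^sup>2 = (\<Sum>i\<in>{- int n..int n}. (v i)\<^sup>2)"
  unfolding Rnorm_def L2_set_def by (simp add: sum_nonneg)

lemma Rnorm_nonneg: "0 \<le> Rnorm n v"
  by (simp add: Rnorm_def)

lemma Rnorm_coord_proj_le: "Rnorm n (coord_proj n x) \<le> norm x"
proof (rule power2_le_imp_le)
  show "(Rnorm n (coord_proj n x))\<^sup>2 \<le> (norm x)\<^sup>2"
    unfolding Rnorm_power2 coord_proj_def
    using sum_coord_le_norm[of "{- int n..int n}" x] by simp
qed simp

lemma translation_hull_coord_proj_bound:
  assumes g: "g \<in> translation_hull (Rtop n) (\<lambda>t. coord_proj n (f t))"
    and C: "\<And>t. norm (f t) \<le> C"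
  shows "Rnorm n (g t) \<le> C"
proof -
  interpret Metric_space "Rvec n" "Rdist n" by (rule Metric_space_Rvec)
  define z :: "int \<Rightarrow> real" where "z = restrict (\<lambda>_. 0) {- int n..int n}"
  have z: "Rdist n z w = Rnorm n w" for w
    unfolding Rdist_def Rnorm_def z_def L2_set_def by simp
  have "coord_proj n (f t) \<in> mcball z C" for t
    using order_trans[OF Rnorm_coord_proj_le C]
    by (auto simp: mcball_def z) (auto simp: z_def Rvec_def coord_proj_def)
  then have "g t \<in> mcball z C"
    by (intro translation_hull_eval_in_closedin[OF g])
      (auto simp: Rtop_def intro: closedin_mcball)
  then show ?thesis
    by (simp add: z)
qed

section \<open>The energy inequality\<close>

lemma sum_periodic_ext_right_shift:
  fixes \<phi> :: "real \<Rightarrow> real"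
  shows "(\<Sum>i\<in>{- int n..int n}. \<phi> (periodic_ext n v (i + 1))) = (\<Sum>i\<in>{- int n..int n}. \<phi> (v i))"
proof -
  have "(\<Sum>i\<in>{- int n..int n}. \<phi> (periodic_ext n v (i + 1))) =
      (\<Sum>j\<in>{- int n + 1..int n + 1}. \<phi> (periodic_ext n v j))"
    by (rule sum.reindex_bij_witness[where i = "\<lambda>j. j - 1" and j = "\<lambda>i. i + 1"]) auto
  also have "{- int n + 1..int n + 1} = insert (int n + 1) {- int n + 1..int n}" by auto
  also have "(\<Sum>j\<in>insert (int n + 1) {- int n + 1..int n}. \<phi> (periodic_ext n v j)) =
      \<phi> (v (- int n)) + (\<Sum>j\<in>{- int n + 1..int n}. \<phi> (v j))"
    by (subst sum.insert) (auto simp: periodic_ext_def intro!: sum.cong)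
  also have "\<dots> = (\<Sum>i\<in>insert (- int n) {- int n + 1..int n}. \<phi> (v i))"
    by (subst sum.insert) auto
  also have "insert (- int n) {- int n + 1..int n} = {- int n..int n}" by auto
  finally show ?thesis .
qed

text \<open>The reflection \<open>i \<mapsto> - i\<close> exchanges the two ends and reduces this to the right shift.\<close>

lemma sum_periodic_ext_left_shift:
  fixes \<phi> :: "real \<Rightarrow> real"
  shows "(\<Sum>i\<in>{- int n..int n}. \<phi> (periodic_ext n v (i - 1))) = (\<Sum>i\<in>{- int n..int n}. \<phi> (v i))"
proof -
  have "(\<Sum>i\<in>{- int n..int n}. \<phi> (periodic_ext n v (i - 1))) =
      (\<Sum>i\<in>{- int n..int n}. \<phi> (periodic_ext n (\<lambda>j. v (- j)) (i + 1)))"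
    by (rule sum.reindex_bij_witness[where i = uminus and j = uminus])
      (auto simp: periodic_ext_def)
  also have "\<dots> = (\<Sum>i\<in>{- int n..int n}. \<phi> (v (- i)))"
    by (rule sum_periodic_ext_right_shift)
  also have "\<dots> = (\<Sum>i\<in>{- int n..int n}. \<phi> (v i))"
    by (rule sum.reindex_bij_witness[where i = uminus and j = uminus]) auto
  finally show ?thesis .
qed

text \<open>
  Each product \<open>v\<^sub>i * v\<^sub>i\<^sub>\<plusminus>\<^sub>1\<close> is at most half the sum of the two squares, and a cyclic shift does
  not change the sum of squares, so after summation the two neighbour terms are at most
  \<open>\<Sum> 2 * v\<^sub>i\<^sup>2\<close>, which the central term \<open>- 2 * v\<^sub>i\<^sup>2\<close> cancels.
\<close>

lemma periodic_laplacian_dissipative: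
  "(\<Sum>i\<in>{- int n..int n}. v i * (periodic_ext n v (i - 1) - 2 * v i + periodic_ext n v (i + 1))) \<le> 0"
proof -
  let ?p = "periodic_ext n v" and ?I = "{- int n..int n}"
  have "(\<Sum>i\<in>?I. v i * (?p (i - 1) - 2 * v i + ?p (i + 1))) \<le>
      (\<Sum>i\<in>?I. (?p (i - 1))\<^sup>2 / 2 + (?p (i + 1))\<^sup>2 / 2 - (v i)\<^sup>2)"
  proof (rule sum_mono)
    fix i
    have "2 * v i * ?p (i - 1) \<le> (v i)\<^sup>2 + (?p (i - 1))\<^sup>2"
      and "2 * v i * ?p (i + 1) \<le> (v i)\<^sup>2 + (?p (i + 1))\<^sup>2"
      by (rule sum_squares_bound)+
    moreover have "v i * (?p (i - 1) - 2 * v i + ?p (i + 1)) =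
        (2 * v i * ?p (i - 1)) / 2 + (2 * v i * ?p (i + 1)) / 2 - 2 * (v i)\<^sup>2"
      unfolding power2_eq_square by algebra
    ultimately show "v i * (?p (i - 1) - 2 * v i + ?p (i + 1)) \<le>
        (?p (i - 1))\<^sup>2 / 2 + (?p (i + 1))\<^sup>2 / 2 - (v i)\<^sup>2"
      by linarith
  qed
  also have "\<dots> = (\<Sum>i\<in>?I. (v i)\<^sup>2 / 2) + (\<Sum>i\<in>?I. (v i)\<^sup>2 / 2) - (\<Sum>i\<in>?I. (v i)\<^sup>2)"
    unfolding sum.distrib sum_subtractf
      sum_periodic_ext_left_shift[of "\<lambda>s. s\<^sup>2 / 2"] sum_periodic_ext_right_shift[of "\<lambda>s. s\<^sup>2 / 2"] ..
  also have "\<dots> = 0"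
    unfolding sum_divide_distrib[symmetric] by linarith
  finally show ?thesis .
qed

text \<open>
  The left-hand side is the derivative of \<open>(Rnorm n (v t))\<^sup>2\<close> along a solution.  The Young weight
  \<open>lam\<close> in \<open>2 * v\<^sub>i * g\<^sub>i \<le> lam * v\<^sub>i\<^sup>2 + g\<^sub>i\<^sup>2 / lam\<close> spends half of the linear damping
  \<open>2 * lam * v\<^sub>i\<^sup>2\<close> on the forcing and keeps the other half.
\<close>

lemma truncated_energy_inequality:
  assumes "0 \<le> \<nu>" "0 < lam" and F: "\<And>s. s * F s \<le> 0" and C: "Rnorm n g \<le> C"
  shows "(\<Sum>i\<in>{- int n..int n}. 2 * v i *
      (\<nu> * (periodic_ext n v (i - 1) - 2 * v i + periodic_ext n v (i + 1))
        - lam * v i + F (v i) + g i)) \<le> - lam * (Rnorm n v)\<^sup>2 + C\<^sup>2 / lam"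
proof -
  let ?I = "{- int n..int n}"
  let ?L = "\<lambda>i. periodic_ext n v (i - 1) - 2 * v i + periodic_ext n v (i + 1)"
  have "(\<Sum>i\<in>?I. 2 * v i * (\<nu> * ?L i - lam * v i + F (v i) + g i)) \<le>
      (\<Sum>i\<in>?I. 2 * \<nu> * (v i * ?L i) - lam * (v i)\<^sup>2 + (g i)\<^sup>2 / lam)"
  proof (rule sum_mono)
    fix i
    have "0 \<le> (lam * v i - g i)\<^sup>2 / lam" using \<open>0 < lam\<close> by simp
    also have "\<dots> = lam * (v i)\<^sup>2 - 2 * v i * g i + (g i)\<^sup>2 / lam"
      using \<open>0 < lam\<close> by (simp add: field_simps power2_eq_square)
    finally have "2 * v i * g i \<le> lam * (v i)\<^sup>2 + (g i)\<^sup>2 / lam" by simp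
    moreover have "2 * v i * (\<nu> * ?L i - lam * v i + F (v i) + g i) =
        2 * \<nu> * (v i * ?L i) - 2 * (lam * (v i)\<^sup>2) + 2 * (v i * F (v i)) + 2 * v i * g i"
      by (simp add: algebra_simps power2_eq_square)
    ultimately show "2 * v i * (\<nu> * ?L i - lam * v i + F (v i) + g i) \<le>
        2 * \<nu> * (v i * ?L i) - lam * (v i)\<^sup>2 + (g i)\<^sup>2 / lam"
      using F[of "v i"] by linarith
  qed
  also have "\<dots> = 2 * \<nu> * (\<Sum>i\<in>?I. v i * ?L i) - lam * (Rnorm n v)\<^sup>2 + (Rnorm n g)\<^sup>2 / lam"
    unfolding Rnorm_power2
    by (simp add: sum.distrib sum_subtractf sum_distrib_left sum_divide_distrib)
  also have "\<dots> \<le> 0 - lam * (Rnorm n v)\<^sup>2 + C\<^sup>2 / lam"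
    using assms periodic_laplacian_dissipative[of v n]
    by (intro add_mono diff_mono divide_right_mono power_mono mult_nonneg_nonpos)
      (auto simp: Rnorm_nonneg)
  finally show ?thesis by simp
qed

section \<open>The uniform bound\<close>

text \<open>
  The integrating factor turns the inequality into the monotonicity of
  \<open>exp (a * t) * (E t - b / a)\<close>, where \<open>b / a\<close> is the equilibrium of \<open>E' = - a * E + b\<close>.
\<close>

lemma linear_differential_inequality_bound:
  fixes E E' :: "real \<Rightarrow> real"
  assumes "0 < a" "0 \<le> b" "0 \<le> E 0" and t: "t \<in> {0..T}"
    and deriv: "\<And>s. s \<in> {0..T} \<Longrightarrow> (E has_real_derivative E' s) (at s within {0..T})"
    and ineq: "\<And>s. s \<in> {0..T} \<Longrightarrow> E' s \<le> - a * E s + b"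
  shows "E t \<le> E 0 + b / a"
proof -
  define W where "W = (\<lambda>s. exp (a * s) * (E s - b / a))"
  have W: "(W has_real_derivative exp (a * s) * (E' s + a * E s - b)) (at s within {0..T})"
    if "s \<in> {0..T}" for s
  proof -
    have "(W has_real_derivative exp (a * s) * a * (E s - b / a) + E' s * exp (a * s))
        (at s within {0..T})"
      unfolding W_def by (rule derivative_eq_intros deriv[OF that] refl | simp)+
    moreover have "exp (a * s) * a * (E s - b / a) + E' s * exp (a * s) =
        exp (a * s) * (E' s + a * E s - b)"
      using \<open>0 < a\<close> by (simp add: algebra_simps)
    ultimately show ?thesis by simp
  qed
  have "W t \<le> W 0"
  proof (rule DERIV_nonpos_imp_decreasing_open[of 0 t W])
    show "0 \<le> t" using t by simp
    show "\<exists>y. (W has_real_derivative y) (at s) \<and> y \<le> 0" if "0 < s" "s < t" for s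
    proof -
      have s: "s \<in> {0..T}" "0 < s" "s < T" using that t by auto
      have "(W has_real_derivative exp (a * s) * (E' s + a * E s - b)) (at s)"
        using W[OF s(1)] s(2,3) by (simp add: at_within_Icc_at)
      moreover have "exp (a * s) * (E' s + a * E s - b) \<le> 0"
        using ineq[OF s(1)] by (intro mult_nonneg_nonpos) auto
      ultimately show ?thesis by blast
    qed
    have "continuous_on {0..T} W"
      using DERIV_continuous[OF W] by (simp add: continuous_on_eq_continuous_within)
    then show "continuous_on {0..t} W"
      by (rule continuous_on_subset) (use t in auto)
  qed
  then have "exp (a * t) * (E t - b / a) \<le> E 0 - b / a" by (simp add: W_def)
  also have "\<dots> \<le> E 0" using assms by simp
  also have "\<dots> \<le> exp (a * t) * E 0"
    using assms mult_right_mono[of 1 "exp (a * t)" "E 0"] by simp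
  finally show ?thesis by simp
qed

lemma truncated_solution_bound:
  assumes "0 \<le> \<nu>" "0 < lam" and F: "\<And>s. s * F s \<le> 0"
    and g: "\<And>t. t \<in> {0..T} \<Longrightarrow> Rnorm n (g t) \<le> C"
    and v: "truncated_solution \<nu> lam F n g T v0 v" and t: "t \<in> {0..T}"
  shows "Rnorm n (v t) \<le> sqrt ((Rnorm n v0)\<^sup>2 + (C / lam)\<^sup>2)"
proof -
  let ?I = "{- int n..int n}"
  define d where "d s i = \<nu> * (periodic_ext n (v s) (i - 1) - 2 * v s i + periodic_ext n (v s) (i + 1))
             - lam * v s i + F (v s i) + g s i" for s i
  have v0: "v 0 = v0" using v by (simp add: truncated_solution_def)
  have dv: "((\<lambda>s. v s i) has_real_derivative d s i) (at s within {0..T})"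
    if "s \<in> {0..T}" "i \<in> ?I" for s i
    using v that unfolding truncated_solution_def d_def by blast
  have "(Rnorm n (v t))\<^sup>2 \<le> (Rnorm n (v 0))\<^sup>2 + (C\<^sup>2 / lam) / lam"
  proof (rule linear_differential_inequality_bound[OF \<open>0 < lam\<close> _ _ t,
        where E' = "\<lambda>s. \<Sum>i\<in>?I. 2 * v s i * d s i"])
    show "0 \<le> C\<^sup>2 / lam" using \<open>0 < lam\<close> by simp
    show "0 \<le> (Rnorm n (v 0))\<^sup>2" by simp
  next
    fix s assume s: "s \<in> {0..T}"
    have "((\<lambda>s. (v s i)\<^sup>2) has_real_derivative 2 * v s i * d s i) (at s within {0..T})"
      if "i \<in> ?I" for i
      by (auto intro!: derivative_eq_intros dv[OF s that])
    then show "((\<lambda>s. (Rnorm n (v s))\<^sup>2) has_real_derivative (\<Sum>i\<in>?I. 2 * v s i * d s i))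
        (at s within {0..T})"
      unfolding Rnorm_power2 by (rule DERIV_sum)
    show "(\<Sum>i\<in>?I. 2 * v s i * d s i) \<le> - lam * (Rnorm n (v s))\<^sup>2 + C\<^sup>2 / lam"
      unfolding d_def
      by (rule truncated_energy_inequality[OF assms(1,2) F g[OF s]])
  qed
  then have "(Rnorm n (v t))\<^sup>2 \<le> (Rnorm n v0)\<^sup>2 + (C / lam)\<^sup>2"
    by (simp add: v0 power2_eq_square)
  then show ?thesis by (rule real_le_rsqrt)
qed

theorem lemma6p1:
  shows "\<exists>M :: real \<Rightarrow> real \<Rightarrow> real \<Rightarrow> real \<Rightarrow> real.
    \<forall>(\<nu> :: real) (lam :: real) (F :: real \<Rightarrow> real) (\<alpha> :: real) (f :: real \<Rightarrow> ell2) (C :: real)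
      (n :: nat) (g :: real \<Rightarrow> int \<Rightarrow> real) (T :: real) (v0 :: int \<Rightarrow> real) (v :: real \<Rightarrow> int \<Rightarrow> real).
      \<nu> > 0 \<longrightarrow> lam > 0 \<longrightarrow>
      continuous_on UNIV F \<longrightarrow> lipschitz_on_bounded F \<longrightarrow> F 0 = 0 \<longrightarrow>
      \<alpha> > 0 \<longrightarrow> (\<forall>s. s * F s \<le> - \<alpha> * s\<^sup>2) \<longrightarrow>
      continuous_on UNIV f \<longrightarrow> lagrange_stable euclidean f \<longrightarrow>
      C = (SUP t. norm (f t)) \<longrightarrow>
      g \<in> translation_hull (Rtop n) (\<lambda>t. coord_proj n (f t)) \<longrightarrow>
      T > 0 \<longrightarrow> v0 \<in> Rvec n \<longrightarrow> truncated_solution \<nu> lam F n g T v0 v \<longrightarrow>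
      (\<forall>t\<in>{0..T}. Rnorm n (v t) \<le> M lam C (Rnorm n v0) T)"
proof (intro exI[of _ "\<lambda>lam C r T. sqrt (r\<^sup>2 + (C / lam)\<^sup>2)"] allI impI ballI)
  fix \<nu> lam \<alpha> C T t :: real and F :: "real \<Rightarrow> real" and f :: "real \<Rightarrow> ell2" and n :: nat
    and g v :: "real \<Rightarrow> int \<Rightarrow> real" and v0 :: "int \<Rightarrow> real"
  assume "0 < \<nu>" "0 < lam" "0 < \<alpha>" and F: "\<forall>s. s * F s \<le> - \<alpha> * s\<^sup>2"
    and f: "continuous_on UNIV f" "lagrange_stable euclidean f" and C: "C = (SUP t. norm (f t))"
    and g: "g \<in> translation_hull (Rtop n) (\<lambda>t. coord_proj n (f t))"
    and v: "truncated_solution \<nu> lam F n g T v0 v" and t: "t \<in> {0..T}"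
  have "bdd_above (range (\<lambda>s. norm (f s)))"
    using lagrange_stable_imp_bounded_range[OF f]
    by (intro bounded_imp_bdd_above) (simp add: bounded_norm_comp)
  then have "norm (f s) \<le> C" for s
    unfolding C by (intro cSUP_upper) auto
  then have gC: "Rnorm n (g s) \<le> C" for s
    by (rule translation_hull_coord_proj_bound[OF g])
  have "s * F s \<le> 0" for s
  proof -
    have "0 \<le> \<alpha> * s\<^sup>2" using \<open>0 < \<alpha>\<close> by simp
    with F[rule_format, of s] show ?thesis by linarith
  qed
  then show "Rnorm n (v t) \<le> sqrt ((Rnorm n v0)\<^sup>2 + (C / lam)\<^sup>2)"
    using \<open>0 < \<nu>\<close> \<open>0 < lam\<close> gC v t by (intro truncated_solution_bound[where F = F]) auto
qed

end
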